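(* Given a finite simple undirected graph $H$, let $G$ be the graph obtained by fully subdividing $H$. Then $$\mathrm{box}(G) \leq \lceil \log_2 \log_2 (\Delta(H)) \rceil + 3 \leq \lceil \log_2 \log_2 (\Delta(G)) \rceil + 3,$$ where $\Delta(H)$ and $\Delta(G)$ denote the maximum degrees of $H$ and $G$ respectively.
   Context: A graph $G$ is obtained by fully subdividing $H$ if $G$ results from subdividing every edge of $H$ exactly once, i.e. each edge $\{u,v\}$ of $H$ is replaced by a path $u,w,v$ with a new vertex $w$ (a different new vertex for each edge). For a positive integer $k$, a $k$-box is a Cartesian product $R_1\times\cdots\times R_k\subseteq\mathbb{R}^k$ of closed intervals $R_i=[a_i,b_i]$. The boxicity $\mathrm{box}(G)$ of a finite simple graph $G$ is the minimum positive integer $k$ such that one can assign to each vertex of $G$ a $k$-box so that two distinct vertices are adjacent if and only if their boxes have non-empty intersection (in particular complete graphs have boxicity $1$). *)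

theory Defs
  imports Complex_Main "HOL-Library.FuncSet"
begin

text \<open>A finite simple undirected graph is a pair of a vertex set and a set of two-element edges.\<close>

type_synonym 'a sgraph = "'a set \<times> 'a set set"

abbreviation graph_verts :: "'a sgraph \<Rightarrow> 'a set" where
  "graph_verts G \<equiv> fst G"

abbreviation graph_edges :: "'a sgraph \<Rightarrow> 'a set set" where
  "graph_edges G \<equiv> snd G"

definition finite_simple_graph :: "'a sgraph \<Rightarrow> bool" where
  "finite_simple_graph G \<longleftrightarrow>
     finite (graph_verts G) \<and> (\<forall>e\<in>graph_edges G. e \<subseteq> graph_verts G \<and> card e = 2)"

definition graph_degree :: "'a sgraph \<Rightarrow> 'a \<Rightarrow> nat" where
  "graph_degree G v = card {e \<in> graph_edges G. v \<in> e}"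

text \<open>On \<^typ>\<open>nat\<close>, the supremum of a finite nonempty set is its maximum, and
  the supremum of the empty set is 0; so the graph without vertices has maximum degree 0.
  Beware that \<open>log 2 (log 2 (real d)) = 0\<close> for \<open>d \<in> {0, 1}\<close>, since \<open>ln 0 = 0\<close>.\<close>

definition graph_max_degree :: "'a sgraph \<Rightarrow> nat" where
  "graph_max_degree G = (SUP v\<in>graph_verts G. graph_degree G v)"

text \<open>The new vertex subdividing the edge \<open>e\<close> is \<open>Inr e\<close>.\<close>

definition full_subdivision :: "'a sgraph \<Rightarrow> ('a + 'a set) sgraph" where
  "full_subdivision H =
     (Inl ` graph_verts H \<union> Inr ` graph_edges H,
      {{Inl u, Inr e} |u e. e \<in> graph_edges H \<and> u \<in> e})"

lemma finite_simple_graph_full_subdivision: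
  assumes "finite_simple_graph H"
  shows "finite_simple_graph (full_subdivision H)"
proof -
  have "graph_edges H \<subseteq> Pow (graph_verts H)"
    using assms by (auto simp: finite_simple_graph_def)
  then have "finite (graph_edges H)"
    using assms by (meson finite_Pow_iff finite_simple_graph_def finite_subset)
  then show ?thesis
    using assms by (fastforce simp: finite_simple_graph_def full_subdivision_def)
qed

text \<open>Points of \<open>\<real>\<^sup>k\<close> are the extensional functions on \<open>{..<k}\<close>, since \<open>k\<close> has to vary in
  the definition of boxicity.\<close>

definition is_kbox :: "nat \<Rightarrow> (nat \<Rightarrow> real) set \<Rightarrow> bool" where
  "is_kbox k B \<longleftrightarrow>
     (\<exists>a b. (\<forall>i<k. a i \<le> b i) \<and> B = (\<Pi>\<^sub>E i\<in>{..<k}. {a i..b i}))"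

definition box_representation ::
    "nat \<Rightarrow> 'a sgraph \<Rightarrow> ('a \<Rightarrow> (nat \<Rightarrow> real) set) \<Rightarrow> bool" where
  "box_representation k G R \<longleftrightarrow>
     (\<forall>v\<in>graph_verts G. is_kbox k (R v)) \<and>
     (\<forall>u\<in>graph_verts G. \<forall>v\<in>graph_verts G. u \<noteq> v \<longrightarrow>
        ({u, v} \<in> graph_edges G \<longleftrightarrow> R u \<inter> R v \<noteq> {}))"

definition boxicity :: "'a sgraph \<Rightarrow> nat" where
  "boxicity G = (LEAST k. 0 < k \<and> (\<exists>R. box_representation k G R))"

end

(*
  For a linear order of V(H), let each vertex be a point and each edge the interval spanned by
  its two ends. So all that is needed is a small family of orders such that each vertex outside an
  edge fails to lie between its ends in one of them. On 2^(2^t) points, t + 1 orders suffice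
  even for all triples (the extremal example for the Erdos-Szekeres theorem): going from n to
  n * n points, order pairs lexicographically and add one order with the second component
  reversed. Now colour V(H) with 2^(2^t) >= Delta(H) colours so that the number of
  monochromatic edges is minimal; the monochromatic edges then form a matching. Lifting the
  orders lexicographically from the colours to V(H), with the pairs of the matching
  consecutive inside their colour class, costs one more order, and one last coordinate
  separates the edges of H from each other.
*)
theory Submission imports Defs begin

section \<open>Families of orders separating a point from a pair\<close>

text \<open>The weak inequalities match closed intervals: this is membership of \<open>f x\<close>
  in the interval spanned by \<open>f a\<close> and \<open>f b\<close>, that is, intersection of a
  point with an interval in one coordinate.\<close>

definition between :: "('a \<Rightarrow> 'b::linorder) \<Rightarrow> 'a \<Rightarrow> 'a \<Rightarrow> 'a \<Rightarrow> bool" where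
  "between f x a b \<longleftrightarrow> f a \<le> f x \<and> f x \<le> f b \<or> f b \<le> f x \<and> f x \<le> f a"

lemma between_commute: "between f x a b \<longleftrightarrow> between f x b a"
  by (auto simp: between_def)

definition separating_orders :: "nat \<Rightarrow> 'a set \<Rightarrow> (nat \<Rightarrow> 'a \<Rightarrow> 'b::linorder) \<Rightarrow> bool" where
  "separating_orders k A g \<longleftrightarrow> (\<forall>i<k. inj_on (g i) A) \<and>
     (\<forall>x\<in>A. \<forall>a\<in>A. \<forall>b\<in>A. x \<noteq> a \<longrightarrow> x \<noteq> b \<longrightarrow> a \<noteq> b \<longrightarrow> (\<exists>i<k. \<not> between (g i) x a b))"

lemma separating_ordersD:
  assumes "separating_orders k A g"
  shows "i < k \<Longrightarrow> inj_on (g i) A"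
    and "\<lbrakk>x \<in> A; a \<in> A; b \<in> A; x \<noteq> a; x \<noteq> b; a \<noteq> b\<rbrakk> \<Longrightarrow> \<exists>i<k. \<not> between (g i) x a b"
  using assms unfolding separating_orders_def by blast+

text \<open>Integer labels for the lexicographic order on pairs with second component strictly
  between \<open>- N\<close> and \<open>N\<close>. Width \<open>2 * N\<close> keeps different first
  components apart; the range is symmetric so that negation can reverse the second
  component.\<close>

definition lex_code :: "int \<Rightarrow> int \<Rightarrow> int \<Rightarrow> int" where
  "lex_code N p q = p * (2 * N) + q"

lemma lex_code_less:
  assumes "p < p'" "\<bar>q\<bar> < N" "\<bar>q'\<bar> < N"
  shows "lex_code N p q < lex_code N p' q'"
proof -
  have "(p + 1) * (2 * N) \<le> p' * (2 * N)"
    using assms by (intro mult_right_mono) auto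
  then show ?thesis
    using assms by (simp add: lex_code_def algebra_simps)
qed

lemma lex_code_le_iff:
  assumes "\<bar>q\<bar> < N" "\<bar>q'\<bar> < N"
  shows "lex_code N p q \<le> lex_code N p' q' \<longleftrightarrow> p < p' \<or> p = p' \<and> q \<le> q'"
proof (cases p p' rule: linorder_cases)
  case equal
  then show ?thesis by (simp add: lex_code_def)
qed (use lex_code_less assms in \<open>force+\<close>)

definition lex_orders ::
    "int \<Rightarrow> nat \<Rightarrow> (nat \<Rightarrow> 'c \<Rightarrow> int) \<Rightarrow> ('a \<Rightarrow> 'c) \<Rightarrow> (nat \<Rightarrow> 'a \<Rightarrow> int) \<Rightarrow> nat \<Rightarrow> 'a \<Rightarrow> int" where
  "lex_orders N k g c h i v =
     (if i < k then lex_code N (g i (c v)) (h i v) else lex_code N (g 0 (c v)) (- h 0 v))"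

lemma inj_on_lex_orders:
  assumes k: "0 < k"
    and g: "\<And>i. i < k \<Longrightarrow> inj_on (g i) A" and c: "c ` V \<subseteq> A"
    and h: "\<And>i v. i < k \<Longrightarrow> v \<in> V \<Longrightarrow> \<bar>h i v\<bar> < N"
    and inj: "\<And>i. i < k \<Longrightarrow> inj_on (\<lambda>v. (c v, h i v)) V"
  shows "inj_on (lex_orders N k g c h i) V"
proof (rule inj_onI)
  fix u v assume uv: "u \<in> V" "v \<in> V" and eq: "lex_orders N k g c h i u = lex_orders N k g c h i v"
  \<comment> \<open>The index whose \<open>g\<close> and \<open>h\<close> underlie order
    \<open>i\<close>: every index from \<open>k\<close> on stands for order 0 with its fibres
    reversed.\<close>
  define j where "j = (if i < k then i else 0)"
  have j: "j < k" using k by (simp add: j_def)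
  define q where "q w = (if i < k then h j w else - h j w)" for w
  have q: "\<bar>q u\<bar> < N" "\<bar>q v\<bar> < N"
    using h[OF j] uv by (simp_all add: q_def)
  have "lex_code N (g j (c u)) (q u) = lex_code N (g j (c v)) (q v)"
    using eq by (simp add: lex_orders_def j_def q_def split: if_splits)
  then have "g j (c u) = g j (c v) \<and> q u = q v"
    using lex_code_le_iff[OF q, of "g j (c u)" "g j (c v)"]
      lex_code_le_iff[OF q(2,1), of "g j (c v)" "g j (c u)"] by linarith
  then have "g j (c u) = g j (c v) \<and> h j u = h j v"
    by (simp add: q_def split: if_splits)
  then show "u = v"
    using inj_onD[OF g[OF j], of "c u" "c v"] inj_onD[OF inj[OF j], of u v] c uv by auto
qed

text \<open>Everything depends on how the three points fall into the fibres of \<open>c\<close>.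
  Three fibres: an order \<open>g i\<close> decides. One fibre: the assumption \<open>fibre\<close>
  applies. If only \<open>a\<close> and \<open>b\<close> share a fibre, that fibre is consecutive in
  order 0 and \<open>x\<close> lies outside it. The reversed order serves the case where
  \<open>x\<close> shares its fibre with exactly one of \<open>a\<close> and
  \<open>b\<close>.\<close>

lemma lex_orders_separate:
  assumes k: "0 < k"
    and g: "\<And>i. i < k \<Longrightarrow> inj_on (g i) A" and c: "c ` V \<subseteq> A"
    and sep: "\<And>x a b. \<lbrakk>x \<in> A; a \<in> A; b \<in> A; x \<noteq> a; x \<noteq> b; a \<noteq> b\<rbrakk> \<Longrightarrow>
                \<exists>i<k. \<not> between (g i) x a b"
    and h: "\<And>i v. i < k \<Longrightarrow> v \<in> V \<Longrightarrow> \<bar>h i v\<bar> < N"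
    and inj: "\<And>i. i < k \<Longrightarrow> inj_on (\<lambda>v. (c v, h i v)) V"
    and V: "x \<in> V" "a \<in> V" "b \<in> V" and ne: "x \<noteq> a" "x \<noteq> b"
    and fibre: "c x = c a \<Longrightarrow> c x = c b \<Longrightarrow> \<exists>i<k. \<not> between (h i) x a b"
  shows "\<exists>i<Suc k. \<not> between (lex_orders N k g c h i) x a b"
proof -
  note le = lex_code_le_iff[OF h h] lex_code_le_iff[of "- _" N "- _", unfolded abs_minus_cancel, OF h h]
  \<comment> \<open>Order \<open>k\<close> agrees with order 0 on distinct fibres but runs backwards
    inside each. So \<open>b\<close> stays on its side of the common fibre of \<open>x\<close> and
    \<open>a\<close>, while \<open>x\<close> changes sides of \<open>a\<close>; in one of the two
    orders \<open>a\<close> lies strictly between \<open>x\<close> and \<open>b\<close>.\<close>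
  have one_side: "\<exists>i<Suc k. \<not> between (lex_orders N k g c h i) x a b"
    if "a \<in> V" "b \<in> V" "x \<noteq> a" "c x = c a" "c x \<noteq> c b" for a b
  proof -
    have "h 0 x \<noteq> h 0 a"
      using inj[OF k] V that by (auto simp: inj_on_def)
    moreover have "g 0 (c x) \<noteq> g 0 (c b)"
      using g[OF k] c V that by (auto simp: inj_on_def)
    ultimately have "\<not> between (lex_orders N k g c h 0) x a b
        \<or> \<not> between (lex_orders N k g c h k) x a b"
      using k V that by (auto simp: between_def lex_orders_def le)
    then show ?thesis using k by auto
  qed
  consider "c x = c a" "c x = c b" | "c x = c a" "c x \<noteq> c b" | "c x \<noteq> c a" "c x = c b"
    | "c x \<noteq> c a" "c x \<noteq> c b" "c a = c b" | "c x \<noteq> c a" "c x \<noteq> c b" "c a \<noteq> c b"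
    by blast
  then show ?thesis
  proof cases
    case 1
    then obtain i where i: "i < k" "\<not> between (h i) x a b" using fibre by blast
    then have "\<not> between (lex_orders N k g c h i) x a b"
      using V 1 by (auto simp: between_def lex_orders_def le)
    then show ?thesis using i by (meson less_SucI)
  next
    case 2
    then show ?thesis using one_side V ne by blast
  next
    case 3
    then show ?thesis using one_side[of b a] V ne between_commute by metis
  next
    case 4
    have "g 0 (c x) \<noteq> g 0 (c a)"
      using g[OF k] c V 4 by (auto simp: inj_on_def)
    then have "\<not> between (lex_orders N k g c h 0) x a b"
      using k V 4 by (auto simp: between_def lex_orders_def le)
    then show ?thesis by blast
  next
    case 5
    then obtain i where i: "i < k" "\<not> between (g i) (c x) (c a) (c b)"
      using sep[of "c x" "c a" "c b"] V c by blast
    have "g i (c x) \<noteq> g i (c a)" "g i (c x) \<noteq> g i (c b)"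
      using g[OF i(1)] c V 5 by (auto simp: inj_on_def)
    then have "\<not> between (lex_orders N k g c h i) x a b"
      using i V by (auto simp: between_def lex_orders_def le)
    then show ?thesis using i by (meson less_SucI)
  qed
qed

lemma finite_family_bound:
  assumes "finite V"
  shows "\<exists>N::int. \<forall>i<k::nat. \<forall>v\<in>V. \<bar>h i v\<bar> < N"
proof -
  have "finite ((\<lambda>(i, v). \<bar>h i v\<bar>) ` ({..<k} \<times> V))" using assms by simp
  then obtain N where "\<forall>y\<in>(\<lambda>(i, v). \<bar>h i v\<bar>) ` ({..<k} \<times> V). y \<le> N"
    using bdd_above_finite bdd_above_def by metis
  then have "\<forall>i<k. \<forall>v\<in>V. \<bar>h i v\<bar> < N + 1" by force
  then show ?thesis by blast
qed

lemma separating_orders_exist: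
  "\<exists>g :: nat \<Rightarrow> nat \<Rightarrow> int. separating_orders (Suc t) {..<2 ^ 2 ^ t} g"
proof (induction t)
  case 0
  \<comment> \<open>Two points contain no three distinct ones, so a single order is enough.\<close>
  show ?case by (intro exI[of _ "\<lambda>_. int"]) (auto simp: separating_orders_def)
next
  case (Suc t)
  define n :: nat where "n = 2 ^ 2 ^ t"
  have n: "n > 0" "2 ^ 2 ^ Suc t = n * n"
    by (simp_all add: n_def mult_2 flip: power_add)
  obtain g :: "nat \<Rightarrow> nat \<Rightarrow> int" where "separating_orders (Suc t) {..<n} g"
    using Suc.IH unfolding n_def by blast
  note inj = separating_ordersD(1)[OF this] and sep = separating_ordersD(2)[OF this]
  define V where "V = {..<n * n}"
  define c where "c v = v div n" for v
  define h where "h i v = g i (v mod n)" for i v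
  obtain N where N: "\<And>i v. i < Suc t \<Longrightarrow> v \<in> V \<Longrightarrow> \<bar>h i v\<bar> < N"
    using finite_family_bound[of V "Suc t" h] by (auto simp: V_def)
  have c: "c ` V \<subseteq> {..<n}"
    by (auto simp: c_def V_def less_mult_imp_div_less)
  have mod_eq: "u mod n = v mod n" if "h i u = h i v" "i < Suc t" for i u v
    using inj[OF that(2)] that(1) n(1) by (auto simp: inj_on_def h_def)
  have inj_h: "inj_on (\<lambda>v. (c v, h i v)) V" if "i < Suc t" for i
    using mod_eq[OF _ that] by (auto intro!: inj_onI simp: c_def) (metis div_mult_mod_eq)
  \<comment> \<open>Distinct points with equal quotients have distinct remainders, so the induction
    hypothesis serves a second time, now inside the fibres.\<close>
  have fibre: "\<exists>i<Suc t. \<not> between (h i) x a b"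
    if "c x = c a" "c x = c b" "x \<noteq> a" "x \<noteq> b" "a \<noteq> b" for x a b
  proof -
    have "x mod n \<noteq> a mod n" "x mod n \<noteq> b mod n" "a mod n \<noteq> b mod n"
      using that unfolding c_def by (metis div_mult_mod_eq)+
    then have "\<exists>i<Suc t. \<not> between (g i) (x mod n) (a mod n) (b mod n)"
      using sep n(1) by simp
    then show ?thesis by (simp add: between_def h_def)
  qed
  let ?f = "lex_orders N (Suc t) g c h"
  have "inj_on (?f i) V" for i
    by (rule inj_on_lex_orders[where A = "{..<n}"]) (use inj c N inj_h in auto)
  moreover have "\<exists>i<Suc (Suc t). \<not> between (?f i) x a b"
    if "x \<in> V" "a \<in> V" "b \<in> V" "x \<noteq> a" "x \<noteq> b" "a \<noteq> b" for x a b
    by (rule lex_orders_separate[where A = "{..<n}", OF _ inj c sep N inj_h that(1-5) fibre])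
       (use that in auto)
  ultimately show ?case
    unfolding n(2) V_def separating_orders_def by (intro exI[of _ ?f]) auto
qed

section \<open>Colourings whose monochromatic edges form a matching\<close>

lemma finite_graph_edges: "finite_simple_graph H \<Longrightarrow> finite (graph_edges H)"
  by (rule finite_subset[of _ "Pow (graph_verts H)"]) (auto simp: finite_simple_graph_def)

text \<open>Minimise the number of monochromatic edges. If two of them met at \<open>v\<close>, then
  by minimality recolouring \<open>v\<close> with any of the \<open>m\<close> colours would again
  leave at least two there. So \<open>v\<close> would have two neighbours of each colour and degree
  at least \<open>2 * m\<close>.\<close>

lemma defective_colouring:
  fixes H :: "'a sgraph"
  assumes H: "finite_simple_graph H" and m: "0 < m"
    and deg: "\<And>v. v \<in> graph_verts H \<Longrightarrow> graph_degree H v \<le> m"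
  obtains c :: "'a \<Rightarrow> nat" where "range c \<subseteq> {..<m}"
    and "\<And>v. v \<in> graph_verts H \<Longrightarrow>
           card {e \<in> graph_edges H. v \<in> e \<and> (\<exists>j. c ` e = {j})} \<le> 1"
proof -
  let ?E = "graph_edges H"
  note fin = finite_graph_edges[OF H]
  define mono where "mono c = {e \<in> ?E. \<exists>j. c ` e = {j}}" for c :: "'a \<Rightarrow> nat"
  obtain c where c: "range c \<subseteq> {..<m}"
    and min: "\<And>d. range d \<subseteq> {..<m} \<Longrightarrow> card (mono c) \<le> card (mono d)"
    using ex_has_least_nat[of "\<lambda>c. range c \<subseteq> {..<m}" "\<lambda>_. 0" "\<lambda>c. card (mono c)"] m
    by auto
  have "card {e \<in> ?E. v \<in> e \<and> (\<exists>j. c ` e = {j})} \<le> 1" if v: "v \<in> graph_verts H" for v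
  proof (rule ccontr)
    \<comment> \<open>The edges at \<open>v\<close> that become monochromatic when \<open>v\<close>
      gets colour \<open>j\<close>; the present colour of \<open>v\<close> does not enter. The edges
      in \<open>rest\<close> are unaffected by recolouring \<open>v\<close>.\<close>
    define S where "S j = {e \<in> ?E. v \<in> e \<and> c ` (e - {v}) = {j}}" for j
    define rest where "rest = {e \<in> mono c. v \<notin> e}"
    have finS: "finite (S j)" "finite rest" for j
      using fin by (auto simp: S_def rest_def mono_def)
    have other: "\<exists>w. w \<noteq> v \<and> e = {v, w}" if "e \<in> ?E" "v \<in> e" for e
    proof -
      have "card e = 2" using H that by (auto simp: finite_simple_graph_def)
      then show ?thesis using that(2) by (auto simp: card_2_iff doubleton_eq_iff)
    qed
    have at_v: "{e \<in> ?E. v \<in> e \<and> (\<exists>i. (c(v := j)) ` e = {i})} = S j" for j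
    proof -
      have "(\<exists>i. (c(v := j)) ` e = {i}) \<longleftrightarrow> c ` (e - {v}) = {j}" if "e \<in> ?E" "v \<in> e" for e
      proof -
        obtain w where "w \<noteq> v" "e = {v, w}" using other[OF \<open>e \<in> ?E\<close> \<open>v \<in> e\<close>] by blast
        then have "(c(v := j)) ` e = {j, c w}" "e - {v} = {w}" by auto
        then show ?thesis by auto
      qed
      then show ?thesis unfolding S_def by blast
    qed
    have mono_upd: "mono (c(v := j)) = rest \<union> S j" for j
    proof -
      have "(c(v := j)) ` e = c ` e" if "v \<notin> e" for e
        using that by (intro image_cong) auto
      then have "{e \<in> mono (c(v := j)). v \<notin> e} = rest"
        by (auto simp: mono_def rest_def)
      moreover have "{e \<in> mono (c(v := j)). v \<in> e} = S j"
        using at_v[of j] by (auto simp: mono_def)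
      ultimately show ?thesis by blast
    qed
    have card_upd: "card (mono (c(v := j))) = card rest + card (S j)" for j
      unfolding mono_upd by (rule card_Un_disjoint) (use finS in \<open>auto simp: rest_def S_def\<close>)
    assume "\<not> card {e \<in> ?E. v \<in> e \<and> (\<exists>j. c ` e = {j})} \<le> 1"
    \<comment> \<open>Recolouring \<open>v\<close> with its own colour changes nothing, so
      \<open>S (c v)\<close> is the present set of monochromatic edges at \<open>v\<close>.\<close>
    then have two: "2 \<le> card (S (c v))"
      using at_v[of "c v"] by simp
    have "2 \<le> card (S j)" if "j < m" for j
    proof -
      have "card (mono c) \<le> card (mono (c(v := j)))"
        using c that by (intro min) (auto simp: image_subset_iff)
      then show ?thesis
        using two card_upd[of j] card_upd[of "c v"] by simp
    qed
    then have "2 * m \<le> (\<Sum>j<m. card (S j))"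
      using sum_bounded_below[of "{..<m}" 2 "\<lambda>j. card (S j)"] by (simp add: mult.commute)
    also have "\<dots> = card (\<Union>j<m. S j)"
      using finS by (intro card_UN_disjoint[symmetric]) (auto simp: S_def)
    also have "\<dots> \<le> graph_degree H v"
      unfolding graph_degree_def using fin by (intro card_mono) (auto simp: S_def)
    finally show False using deg[OF v] m by simp
  qed
  with c show ?thesis using that by blast
qed

text \<open>The members of \<open>M\<close> and the remaining singletons partition \<open>V\<close>
  into blocks. Sorting by the least label in the block, and then by the label itself, makes every
  block consecutive.\<close>

lemma matching_consecutive_order:
  assumes V: "finite V" and M: "\<And>e. e \<in> M \<Longrightarrow> e \<subseteq> V"
    and disj: "\<And>e e'. e \<in> M \<Longrightarrow> e' \<in> M \<Longrightarrow> e \<noteq> e' \<Longrightarrow> e \<inter> e' = {}"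
  obtains h :: "'a \<Rightarrow> int" where "inj_on h V"
    and "\<And>x a b. \<lbrakk>x \<in> V; {a, b} \<in> M; x \<noteq> a; x \<noteq> b\<rbrakk> \<Longrightarrow> \<not> between h x a b"
proof -
  obtain f :: "'a \<Rightarrow> nat" and n where f: "f ` V = {i. i < n}" "inj_on f V"
    using finite_imp_inj_to_nat_seg[OF V] by blast
  define blk where "blk v = (if \<exists>e\<in>M. v \<in> e then (THE e. e \<in> M \<and> v \<in> e) else {v})" for v
  define rep where "rep v = Min (f ` blk v)" for v
  have blk_M: "blk v = e" if "e \<in> M" "v \<in> e" for v e
    unfolding blk_def using that disj by (auto intro!: the_equality)
  have blk_other: "blk v = {v}" if "\<not> (\<exists>e\<in>M. v \<in> e)" for v
    using that by (auto simp: blk_def)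
  have blk: "v \<in> blk v" "blk v \<subseteq> V" if "v \<in> V" for v
    using blk_M[of _ v] blk_other[of v] M that by (cases "\<exists>e\<in>M. v \<in> e"; fastforce)+
  have blk_eq: "blk w = blk v" if "w \<in> blk v" for v w
    using that blk_M[of _ v] blk_M[of _ w] blk_other[of v] by (cases "\<exists>e\<in>M. v \<in> e") auto
  have rep: "rep v \<in> f ` blk v" if "v \<in> V" for v
  proof -
    have "finite (f ` blk v)" "f ` blk v \<noteq> {}"
      using blk[OF that] V finite_subset by auto
    then show ?thesis unfolding rep_def by (rule Min_in)
  qed
  \<comment> \<open>The least label is attained inside the block and labels are injective, so it
    identifies the block.\<close>
  have rep_eq: "blk u = blk v" if uv: "u \<in> V" "v \<in> V" and eq: "rep u = rep v" for u v
  proof -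
    obtain p q where "p \<in> blk u" "q \<in> blk v" "f p = f q"
      using rep[OF uv(1)] rep[OF uv(2)] eq by auto
    moreover from this have "p = q"
      using f(2) blk(2) uv by (meson inj_onD subsetD)
    ultimately show ?thesis using blk_eq by metis
  qed
  define h where "h v = lex_code (int n) (int (rep v)) (int (f v))" for v
  have le: "h u \<le> h v \<longleftrightarrow> rep u < rep v \<or> rep u = rep v \<and> f u \<le> f v" if "u \<in> V" "v \<in> V" for u v
    unfolding h_def using f(1) that by (subst lex_code_le_iff) auto
  have "inj_on h V"
  proof (rule inj_onI)
    fix u v assume "u \<in> V" "v \<in> V" "h u = h v"
    then show "u = v"
      using le[of u v] le[of v u] f(2) by (auto dest: inj_onD)
  qed
  moreover have "\<not> between h x a b" if "x \<in> V" "{a, b} \<in> M" "x \<noteq> a" "x \<noteq> b" for x a b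
  proof -
    have ab: "a \<in> V" "b \<in> V" using M that by auto
    have "blk a = {a, b}" "blk b = {a, b}" using blk_M that by auto
    then have "rep a = rep b" "blk x \<noteq> blk a"
      using blk(1)[OF that(1)] that by (auto simp: rep_def)
    moreover have "rep x \<noteq> rep a"
      using rep_eq ab that(1) calculation by blast
    ultimately show ?thesis
      using le that ab by (auto simp: between_def)
  qed
  ultimately show ?thesis using that by blast
qed

text \<open>The count is \<open>t + 1\<close> orders on the \<open>2 ^ 2 ^ t\<close> colours plus
  the reversed one. The same \<open>h\<close> orders the colour classes in all of them.\<close>

lemma separating_vertex_orders:
  fixes H :: "'a sgraph"
  assumes H: "finite_simple_graph H"
    and deg: "\<And>v. v \<in> graph_verts H \<Longrightarrow> graph_degree H v \<le> 2 ^ 2 ^ t"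
  obtains f :: "nat \<Rightarrow> 'a \<Rightarrow> int" where "\<And>i. inj_on (f i) (graph_verts H)"
    and "\<And>x a b. \<lbrakk>x \<in> graph_verts H; {a, b} \<in> graph_edges H; x \<noteq> a; x \<noteq> b\<rbrakk> \<Longrightarrow>
           \<exists>i<t + 2. \<not> between (f i) x a b"
proof -
  let ?V = "graph_verts H" and ?E = "graph_edges H"
  have V: "finite ?V" and E: "\<And>e. e \<in> ?E \<Longrightarrow> e \<subseteq> ?V"
    using H by (auto simp: finite_simple_graph_def)
  define n :: nat where "n = 2 ^ 2 ^ t"
  have "0 < n" by (simp add: n_def)
  then obtain c :: "'a \<Rightarrow> nat" where c: "range c \<subseteq> {..<n}"
    and defect: "\<And>v. v \<in> ?V \<Longrightarrow> card {e \<in> ?E. v \<in> e \<and> (\<exists>j. c ` e = {j})} \<le> 1"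
    using defective_colouring[OF H \<open>0 < n\<close> deg[folded n_def]] by blast
  define M where "M = {e \<in> ?E. \<exists>j. c ` e = {j}}"
  have disj: "e \<inter> e' = {}" if e: "e \<in> M" "e' \<in> M" "e \<noteq> e'" for e e'
  proof (rule ccontr)
    assume "e \<inter> e' \<noteq> {}"
    then obtain v where v: "v \<in> e" "v \<in> e'" by blast
    then have "v \<in> ?V" using e E by (auto simp: M_def)
    have "card {e, e'} \<le> card {e \<in> ?E. v \<in> e \<and> (\<exists>j. c ` e = {j})}"
      using e v finite_graph_edges[OF H] by (intro card_mono) (auto simp: M_def)
    then show False using defect[OF \<open>v \<in> ?V\<close>] e by simp
  qed
  obtain h :: "'a \<Rightarrow> int" where inj_h: "inj_on h ?V"
    and sep_h: "\<And>x a b. \<lbrakk>x \<in> ?V; {a, b} \<in> M; x \<noteq> a; x \<noteq> b\<rbrakk> \<Longrightarrow> \<not> between h x a b"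
    using matching_consecutive_order[OF V, of M] disj E by (metis (no_types, lifting) M_def mem_Collect_eq)
  obtain g :: "nat \<Rightarrow> nat \<Rightarrow> int" where "separating_orders (Suc t) {..<n} g"
    using separating_orders_exist[of t] unfolding n_def by blast
  note inj_g = separating_ordersD(1)[OF this] and sep_g = separating_ordersD(2)[OF this]
  obtain N where N: "\<And>v. v \<in> ?V \<Longrightarrow> \<bar>h v\<bar> < N"
    using finite_family_bound[OF V, of 1 "\<lambda>_. h"] by auto
  have inj_ch: "inj_on (\<lambda>v. (c v, h v)) ?V"
    using inj_h by (auto simp: inj_on_def)
  have cV: "c ` ?V \<subseteq> {..<n}" using c by auto
  let ?f = "lex_orders N (Suc t) g c (\<lambda>_. h)"
  have "inj_on (?f i) ?V" for i
    by (rule inj_on_lex_orders[where A = "{..<n}"]) (use inj_g cV N inj_ch in auto)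
  moreover have "\<exists>i<t + 2. \<not> between (?f i) x a b"
    if x: "x \<in> ?V" "{a, b} \<in> ?E" "x \<noteq> a" "x \<noteq> b" for x a b
  proof -
    have ab: "a \<in> ?V" "b \<in> ?V" using E x(2) by auto
    \<comment> \<open>If all three colours agree, the edge is monochromatic and hence in
      \<open>M\<close>, whose pairs are consecutive under \<open>h\<close>.\<close>
    have "\<exists>i<Suc t. \<not> between h x a b" if "c x = c a" "c x = c b"
      using sep_h[of x a b] x that by (auto simp: M_def)
    then have "\<exists>i<Suc (Suc t). \<not> between (?f i) x a b"
      by (intro lex_orders_separate[where A = "{..<n}", OF _ inj_g cV sep_g N inj_ch x(1) ab x(3,4)])
         auto
    then show ?thesis by simp
  qed
  ultimately show ?thesis using that by blast
qed

section \<open>Boxes\<close>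

text \<open>Reduces boxes to inequalities between endpoints: two products of intervals meet exactly
  when the intervals meet in every coordinate.\<close>

lemma boxicity_le:
  fixes lo hi :: "nat \<Rightarrow> 'a \<Rightarrow> real"
  assumes k: "0 < k"
    and le: "\<And>i v. i < k \<Longrightarrow> v \<in> graph_verts G \<Longrightarrow> lo i v \<le> hi i v"
    and adj: "\<And>u v. \<lbrakk>u \<in> graph_verts G; v \<in> graph_verts G; u \<noteq> v\<rbrakk> \<Longrightarrow>
      {u, v} \<in> graph_edges G \<longleftrightarrow> (\<forall>i<k. lo i u \<le> hi i v \<and> lo i v \<le> hi i u)"
  shows "boxicity G \<le> k"
proof -
  define R where "R v = (\<Pi>\<^sub>E i\<in>{..<k}. {lo i v..hi i v})" for v
  have "R u \<inter> R v \<noteq> {} \<longleftrightarrow> (\<forall>i<k. lo i u \<le> hi i v \<and> lo i v \<le> hi i u)"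
    if "u \<in> graph_verts G" "v \<in> graph_verts G" for u v
  proof -
    have "R u \<inter> R v = (\<Pi>\<^sub>E i\<in>{..<k}. {max (lo i u) (lo i v)..min (hi i u) (hi i v)})"
      by (simp add: R_def PiE_Int)
    then show ?thesis
      using le[OF _ that(1)] le[OF _ that(2)] by (auto simp: PiE_eq_empty_iff)
  qed
  moreover have "is_kbox k (R v)" if "v \<in> graph_verts G" for v
    unfolding is_kbox_def R_def using le that
    by (intro exI[of _ "\<lambda>i. lo i v"] exI[of _ "\<lambda>i. hi i v"]) auto
  ultimately have "box_representation k G R"
    using adj by (simp add: box_representation_def)
  then show ?thesis
    unfolding boxicity_def using k by (intro Least_le) auto
qed

lemma boxicity_full_subdivision_le:
  fixes H :: "'a sgraph"
  assumes H: "finite_simple_graph H"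
    and deg: "\<And>v. v \<in> graph_verts H \<Longrightarrow> graph_degree H v \<le> 2 ^ 2 ^ t"
  shows "boxicity (full_subdivision H) \<le> t + 3"
proof -
  let ?V = "graph_verts H" and ?E = "graph_edges H" and ?G = "full_subdivision H"
  obtain f :: "nat \<Rightarrow> 'a \<Rightarrow> int" where inj: "\<And>i. inj_on (f i) ?V"
    and sep: "\<And>x a b. \<lbrakk>x \<in> ?V; {a, b} \<in> ?E; x \<noteq> a; x \<noteq> b\<rbrakk> \<Longrightarrow>
           \<exists>i<t + 2. \<not> between (f i) x a b"
    using separating_vertex_orders[OF assms] by blast
  obtain p :: "'a set \<Rightarrow> nat" and n where p: "p ` ?E = {i. i < n}" "inj_on p ?E"
    using finite_imp_inj_to_nat_seg[OF finite_graph_edges[OF H]] by blast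
  \<comment> \<open>In the last coordinate, \<open>t + 2\<close>, edges are distinct points below
    \<open>n\<close> and every vertex gets all of \<open>[0, n]\<close>, so vertex-edge pairs are
    not constrained there.\<close>
  define lo where "lo i z = real_of_int (if i < t + 2
      then case z of Inl v \<Rightarrow> f i v | Inr e \<Rightarrow> Min (f i ` e)
      else case z of Inl v \<Rightarrow> 0 | Inr e \<Rightarrow> int (p e))" for i z
  define hi where "hi i z = real_of_int (if i < t + 2
      then case z of Inl v \<Rightarrow> f i v | Inr e \<Rightarrow> Max (f i ` e)
      else case z of Inl v \<Rightarrow> int n | Inr e \<Rightarrow> int (p e))" for i z
  have edge: "\<exists>a b. a \<noteq> b \<and> e = {a, b}" if "e \<in> ?E" for e
  proof -
    have "card e = 2" using H that by (auto simp: finite_simple_graph_def)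
    then show ?thesis by (auto simp: card_2_iff)
  qed
  have vert_edge: "{Inl u, Inr e} \<in> graph_edges ?G \<longleftrightarrow>
      (\<forall>i<t + 3. lo i (Inl u) \<le> hi i (Inr e) \<and> lo i (Inr e) \<le> hi i (Inl u))"
    if u: "u \<in> ?V" and e: "e \<in> ?E" for u e
  proof -
    obtain a b where ab: "e = {a, b}" using edge[OF e] by blast
    have pn: "p e \<le> n" using imageI[OF e, of p] unfolding p(1) by simp
    have mid: "lo i (Inl u) \<le> hi i (Inr e) \<and> lo i (Inr e) \<le> hi i (Inl u) \<longleftrightarrow> between (f i) u a b"
      if "i < t + 2" for i
      using that by (auto simp: lo_def hi_def ab between_def min_def max_def)
    have "i < t + 3 \<longleftrightarrow> i < t + 2 \<or> i = t + 2" for i by auto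
    moreover have "lo (t + 2) (Inl u) \<le> hi (t + 2) (Inr e) \<and> lo (t + 2) (Inr e) \<le> hi (t + 2) (Inl u)"
      using pn by (simp add: lo_def hi_def)
    ultimately have "(\<forall>i<t + 3. lo i (Inl u) \<le> hi i (Inr e) \<and> lo i (Inr e) \<le> hi i (Inl u))
        \<longleftrightarrow> (\<forall>i<t + 2. between (f i) u a b)"
      using mid by auto
    \<comment> \<open>An end of \<open>e\<close> always lies in the interval of \<open>e\<close>;
      for any other vertex \<open>sep\<close> supplies a coordinate where it does not.\<close>
    also have "\<dots> \<longleftrightarrow> u \<in> e"
      using sep[OF u, of a b] e unfolding ab by (auto simp: between_def)
    also have "\<dots> \<longleftrightarrow> {Inl u, Inr e} \<in> graph_edges ?G"
      using e by (auto simp: full_subdivision_def doubleton_eq_iff)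
    finally show ?thesis by blast
  qed
  show ?thesis
  proof (rule boxicity_le)
    fix i z assume "z \<in> graph_verts ?G"
    then show "lo i z \<le> hi i z"
      using edge by (fastforce simp: lo_def hi_def full_subdivision_def)
  next
    fix y z assume yz: "y \<in> graph_verts ?G" "z \<in> graph_verts ?G" "y \<noteq> z"
    then consider u v where "y = Inl u" "z = Inl v" "u \<in> ?V" "v \<in> ?V" "u \<noteq> v"
      | u e where "y = Inl u" "z = Inr e" "u \<in> ?V" "e \<in> ?E"
      | u e where "y = Inr e" "z = Inl u" "u \<in> ?V" "e \<in> ?E"
      | e e' where "y = Inr e" "z = Inr e'" "e \<in> ?E" "e' \<in> ?E" "e \<noteq> e'"
      by (cases y; cases z) (auto simp: full_subdivision_def)
    then show "{y, z} \<in> graph_edges ?G \<longleftrightarrow> (\<forall>i<t + 3. lo i y \<le> hi i z \<and> lo i z \<le> hi i y)"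
    proof cases
      case 1
      then have "f 0 u \<noteq> f 0 v" using inj[of 0] by (auto dest: inj_onD)
      then have "\<not> (lo 0 y \<le> hi 0 z \<and> lo 0 z \<le> hi 0 y)"
        using 1 by (auto simp: lo_def hi_def)
      moreover have "{y, z} \<notin> graph_edges ?G"
        using 1 by (auto simp: full_subdivision_def doubleton_eq_iff)
      moreover have "0 < t + 3" by simp
      ultimately show ?thesis by blast
    next
      case 2
      then show ?thesis using vert_edge by simp
    next
      case 3
      then show ?thesis using vert_edge[of u e] by (simp add: insert_commute conj_commute)
    next
      case 4
      then have "p e \<noteq> p e'" using p(2) by (auto dest: inj_onD)
      then have "\<not> (lo (t + 2) y \<le> hi (t + 2) z \<and> lo (t + 2) z \<le> hi (t + 2) y)"
        using 4 by (auto simp: lo_def hi_def)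
      moreover have "{y, z} \<notin> graph_edges ?G"
        using 4 by (auto simp: full_subdivision_def doubleton_eq_iff)
      moreover have "t + 2 < t + 3" by simp
      ultimately show ?thesis by blast
    qed
  qed simp
qed

section \<open>Maximum degrees and iterated logarithms\<close>

lemma graph_degree_le_max_degree:
  assumes "finite_simple_graph G" "v \<in> graph_verts G"
  shows "graph_degree G v \<le> graph_max_degree G"
  unfolding graph_max_degree_def using assms
  by (intro cSUP_upper bdd_above_finite) (auto simp: finite_simple_graph_def)

lemma graph_degree_full_subdivision:
  "graph_degree (full_subdivision H) (Inl v) = graph_degree H v"
proof -
  have "{e \<in> graph_edges (full_subdivision H). Inl v \<in> e}
      = (\<lambda>e. {Inl v, Inr e}) ` {e \<in> graph_edges H. v \<in> e}"
    by (auto simp: full_subdivision_def)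
  moreover have "inj_on (\<lambda>e. {Inl v, Inr e}) {e \<in> graph_edges H. v \<in> e}"
    by (auto simp: inj_on_def doubleton_eq_iff)
  ultimately show ?thesis
    by (simp add: graph_degree_def card_image)
qed

text \<open>Old vertices keep their degree. Equality can fail: subdividing a single edge raises the
  maximum degree from 1 to 2.\<close>

lemma graph_max_degree_full_subdivision:
  assumes "finite_simple_graph H"
  shows "graph_max_degree H \<le> graph_max_degree (full_subdivision H)"
proof (cases "graph_verts H = {}")
  case False
  have "graph_degree H v \<le> graph_max_degree (full_subdivision H)" if "v \<in> graph_verts H" for v
  proof -
    have "Inl v \<in> graph_verts (full_subdivision H)"
      using that by (simp add: full_subdivision_def)
    from graph_degree_le_max_degree[OF finite_simple_graph_full_subdivision[OF assms] this]
    show ?thesis by (simp add: graph_degree_full_subdivision)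
  qed
  then show ?thesis
    unfolding graph_max_degree_def[of H] using False by (intro cSUP_least) auto
qed (simp add: graph_max_degree_def)

text \<open>Since \<open>ln 0 = 0\<close>, the iterated logarithm is 0 at 0 and 1. It is also 0 at 2
  and increases from there, so the convention does not break monotonicity.\<close>

lemma log_log_mono:
  assumes "d \<le> d'"
  shows "log 2 (log 2 (real d)) \<le> log 2 (log 2 (real d'))"
proof -
  have nonneg: "0 \<le> log 2 (log 2 (real n))" and small: "n < 2 \<Longrightarrow> log 2 (log 2 (real n)) = 0" for n
  proof -
    show sm: "log 2 (log 2 (real n)) = 0" if "n < 2"
      using that by (cases n) (auto simp: log_def)
    show "0 \<le> log 2 (log 2 (real n))"
      using sm by (cases "n < 2") auto
  qed
  show ?thesis
  proof (cases "d < 2")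
    case True
    then show ?thesis using small nonneg by simp
  next
    case False
    then show ?thesis using assms by simp
  qed
qed

lemma le_double_power_ceiling_log_log: "d \<le> 2 ^ 2 ^ nat \<lceil>log 2 (log 2 (real d))\<rceil>"
proof (cases "d < 2")
  case False
  let ?t = "nat \<lceil>log 2 (log 2 (real d))\<rceil>"
  have "log 2 (log 2 (real d)) \<le> real ?t" by linarith
  then have "log 2 (real d) \<le> 2 powr real ?t"
    using False by (subst (asm) log_le_iff) auto
  then have "real d \<le> 2 powr (2 powr real ?t)"
    using False by (subst (asm) log_le_iff) auto
  also have "\<dots> = 2 powr real (2 ^ ?t)"
    by (simp add: powr_realpow)
  also have "\<dots> = real (2 ^ 2 ^ ?t)"
    by (subst powr_realpow) auto
  finally show ?thesis by (simp only: of_nat_le_iff)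
next
  case True
  \<comment> \<open>Here the logarithms carry no information, but any power of 2 is at least
    1.\<close>
  then have "d \<le> 1" by simp
  also have "1 \<le> (2::nat) ^ n" for n by simp
  finally show ?thesis .
qed

theorem corollary1:
  fixes H :: "'a sgraph" and G :: "('a + 'a set) sgraph"
  assumes "finite_simple_graph H"
    and "G = full_subdivision H"
  shows "int (boxicity G) \<le> \<lceil>log 2 (log 2 (real (graph_max_degree H)))\<rceil> + 3
    \<and> \<lceil>log 2 (log 2 (real (graph_max_degree H)))\<rceil> + 3
        \<le> \<lceil>log 2 (log 2 (real (graph_max_degree G)))\<rceil> + 3"
proof
  let ?L = "log 2 (log 2 (real (graph_max_degree H)))"
  have "boxicity G \<le> nat \<lceil>?L\<rceil> + 3"
    unfolding assms(2)
    using graph_degree_le_max_degree[OF assms(1)] le_double_power_ceiling_log_log order_trans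
    by (intro boxicity_full_subdivision_le[OF assms(1)]) blast
  \<comment> \<open>Nonnegativity makes the truncation by \<open>nat\<close> harmless; it is
    monotonicity from degree 0, where the value is 0.\<close>
  moreover have "0 \<le> ?L"
    using log_log_mono[of 0 "graph_max_degree H"] by (simp add: log_def)
  ultimately show "int (boxicity G) \<le> \<lceil>?L\<rceil> + 3" by linarith
  show "\<lceil>?L\<rceil> + 3 \<le> \<lceil>log 2 (log 2 (real (graph_max_degree G)))\<rceil> + 3"
    using graph_max_degree_full_subdivision[OF assms(1)] unfolding assms(2)
    by (simp add: ceiling_mono log_log_mono)
qed

end
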